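(* Let $Y$ be a finite dimensional Euclidean space, $K\subseteq Y$ a closed convex cone and $k\ge1$ an integer. Then: (1) $\mathrm{FR}_k(K)$ is a convex cone. (2) $\mathrm{FR}_k(K)$ is closed if and only if $K$ is a subspace or $k=1$. (3) If $T\in\operatorname{Aut}(K)$ and $(y_1,\dots,y_k)\in\mathrm{FR}_k(K)$, then $(T^*y_1,\dots,T^*y_k)\in\mathrm{FR}_k(K)$. (4) If $C$ is another closed convex cone (in a finite dimensional Euclidean space), then $$\bigl((y_1,z_1),\dots,(y_k,z_k)\bigr)\in\mathrm{FR}_k(K\times C)$$ if and only if $$(y_1,\dots,y_k)\in\mathrm{FR}_k(K)\quad\text{and}\quad(z_1,\dots,z_k)\in\mathrm{FR}_k(C).$$
   Context: For a closed convex cone $K$, $K^*=\{y:\langle y,x\rangle\ge0\ \forall x\in K\}$, and $$\mathrm{FR}_k(K)=\{(y_1,\dots,y_k): y_1\in K^*,\ y_i\in(K\cap y_1^\perp\cap\dots\cap y_{i-1}^\perp)^*,\ i=2,\dots,k\}\subseteq Y^k.$$ $\operatorname{Aut}(K)$ is the set of invertible linear maps $T:Y\to Y$ with $T(K)=K$; $T^*$ is the adjoint of $T$. *)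

theory Defs
  imports "HOL-Analysis.Analysis"
begin

definition dual_cone :: "'a::real_inner set \<Rightarrow> 'a set" where
  "dual_cone K = {y. \<forall>x\<in>K. 0 \<le> y \<bullet> x}"

text \<open>
  The space of \<open>k\<close>-tuples is the type \<open>'a ^ 'k\<close>, whose index type is finite and linearly ordered;
  the order is that of the positions \<open>1 < 2 < ... < k\<close> with \<open>k = CARD('k)\<close>. Types being nonempty,
  \<open>k \<ge> 1\<close>. At the least index no \<open>j < i\<close> exists, the orthogonal complement is that of the empty
  set, i.e. \<open>UNIV\<close>, and the condition is membership in \<open>dual_cone K\<close>.
\<close>
definition FR :: "'a::real_inner set \<Rightarrow> ('a ^ 'k::{finite,linorder}) set" where
  "FR K = {y. \<forall>i. y $ i \<in> dual_cone (K \<inter> {y $ j | j. j < i}\<^sup>\<bottom>)}"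

definition Aut :: "'a::real_vector set \<Rightarrow> ('a \<Rightarrow> 'a) set" where
  "Aut K = {T. linear T \<and> bij T \<and> T ` K = K}"

end

theory Submission
  imports Defs
begin

text \<open>
  Everything follows from one reformulation: \<open>y\<close> lies in \<open>FR K\<close> exactly when, for each \<open>x \<in> K\<close>,
  the tuple of numbers \<open>y $ i \<bullet> x\<close> is lexicographically nonnegative, because the constraint at
  position \<open>i\<close> concerns only those \<open>x\<close> at which all earlier entries vanish (\<open>FR_iff_lex_nonneg\<close>).

  The lexicographically nonnegative tuples form a convex cone that contains no line
  (\<open>lex_nonneg_add\<close>, \<open>lex_nonneg_uminus_eq_0\<close>). Closure under sums makes \<open>FR K\<close> a convex cone and
  gives the product rule, as \<open>(y, z) \<bullet> (x, w) = y \<bullet> x + z \<bullet> w\<close>; conversely, membership of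
  the components follows by testing at \<open>(x, 0)\<close> and \<open>(0, w)\<close>. The automorphism rule holds because
  \<open>adjoint T y \<bullet> x = y \<bullet> T x\<close> and \<open>T x\<close> stays in \<open>K\<close>.

  If \<open>K\<close> is a subspace, testing at \<open>x\<close> and \<open>-x\<close> forces all entries of \<open>y\<close> to be orthogonal to \<open>K\<close>,
  a closed condition; for a single position \<open>FR K\<close> is just the dual cone. Otherwise there are
  \<open>x \<in> K\<close> and \<open>a\<close> in the dual cone with \<open>a \<bullet> x > 0\<close>. For positions \<open>p < q\<close>, the tuple with
  \<open>\<epsilon> a\<close> at \<open>p\<close>, \<open>-a\<close> at \<open>q\<close> and zeros elsewhere lies in \<open>FR K\<close> for each \<open>\<epsilon> > 0\<close>, since the
  positive entry comes first wherever \<open>a\<close> does not vanish, but not for \<open>\<epsilon> = 0\<close>; so \<open>FR K\<close> is not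
  closed (\<open>not_closed_FR\<close>).
\<close>

definition lex_nonneg :: "('k::linorder \<Rightarrow> real) \<Rightarrow> bool" where
  "lex_nonneg f \<longleftrightarrow> (\<forall>i. (\<forall>j<i. f j = 0) \<longrightarrow> 0 \<le> f i)"

lemma lex_nonneg_0: "lex_nonneg (\<lambda>i. 0)"
  by (simp add: lex_nonneg_def)

lemma lex_nonneg_scale:
  assumes "0 \<le> c" "lex_nonneg f"
  shows "lex_nonneg (\<lambda>i. c * f i)"
  using assms by (cases "c = 0") (auto simp: lex_nonneg_def)

text \<open>At the first position where one of the two tuples is nonzero, both entries are nonnegative, so
  they cannot cancel and the sum is positive there. Hence the sum cannot start with more zeros than
  its summands have in common.\<close>
lemma lex_nonneg_add_eq_0:
  fixes f g :: "'k::{finite,linorder} \<Rightarrow> real"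
  assumes f: "lex_nonneg f" and g: "lex_nonneg g"
    and "\<forall>j<i. f j + g j = 0"
  shows "\<forall>j<i. f j = 0 \<and> g j = 0"
proof -
  \<comment> \<open>the order is well-founded by finiteness, with the size of the initial segment as measure\<close>
  have "j < i \<longrightarrow> f j = 0 \<and> g j = 0" for j
  proof (induction j rule: measure_induct_rule[where f = "\<lambda>j. card {..<j}"])
    case (less j)
    have IH: "\<forall>l<j. f l = 0 \<and> g l = 0" if "j < i"
    proof (intro allI impI)
      fix l
      assume "l < j"
      then have "card {..<l} < card {..<j}"
        by (intro psubset_card_mono) auto
      with less \<open>l < j\<close> that show "f l = 0 \<and> g l = 0"
        by force
    qed
    show ?case
    proof
      assume j: "j < i"
      then have "0 \<le> f j" "0 \<le> g j"
        using IH f g by (simp_all add: lex_nonneg_def)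
      then show "f j = 0 \<and> g j = 0"
        using assms(3)[rule_format, OF j] by linarith
    qed
  qed
  then show ?thesis
    by blast
qed

lemma lex_nonneg_add:
  fixes f g :: "'k::{finite,linorder} \<Rightarrow> real"
  assumes "lex_nonneg f" "lex_nonneg g"
  shows "lex_nonneg (\<lambda>i. f i + g i)"
  unfolding lex_nonneg_def
proof (intro allI impI)
  fix i
  assume "\<forall>j<i. f j + g j = 0"
  then have "\<forall>j<i. f j = 0 \<and> g j = 0"
    by (rule lex_nonneg_add_eq_0[OF assms])
  then show "0 \<le> f i + g i"
    using assms by (simp add: lex_nonneg_def)
qed

lemma lex_nonneg_uminus_eq_0:
  fixes f :: "'k::{finite,linorder} \<Rightarrow> real"
  assumes "lex_nonneg f" "lex_nonneg (\<lambda>i. - f i)"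
  shows "f i = 0"
proof -
  have "\<forall>j<i. f j = 0"
    using lex_nonneg_add_eq_0[OF assms] by simp
  then show ?thesis
    using assms by (intro antisym) (simp_all add: lex_nonneg_def)
qed

lemma FR_iff_lex_nonneg:
  "y \<in> FR K \<longleftrightarrow> (\<forall>x\<in>K. lex_nonneg (\<lambda>i. y $ i \<bullet> x))"
  by (auto simp: FR_def dual_cone_def lex_nonneg_def orthogonal_comp_def orthogonal_def)

lemma convex_cone_FR:
  "convex_cone (FR K :: ('a::real_inner ^ 'k::{finite,linorder}) set)"
  unfolding convex_cone_iff
  by (auto simp: FR_iff_lex_nonneg inner_add_left
      intro: lex_nonneg_0 lex_nonneg_add lex_nonneg_scale)

lemma FR_adjoint:
  fixes K :: "'a::euclidean_space set"
  assumes "T \<in> Aut K" "y \<in> FR K"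
  shows "(\<chi> i. adjoint T (y $ i)) \<in> FR K"
  using assms by (auto simp: Aut_def FR_iff_lex_nonneg adjoint_clauses)

lemma FR_Times_iff:
  fixes y :: "'a::real_inner ^ 'k::{finite,linorder}"
    and z :: "'b::real_inner ^ 'k::{finite,linorder}"
  assumes "0 \<in> K" "0 \<in> C"
  shows "(\<chi> i. (y $ i, z $ i)) \<in> FR (K \<times> C) \<longleftrightarrow> y \<in> FR K \<and> z \<in> FR C"
proof
  assume *: "(\<chi> i. (y $ i, z $ i)) \<in> FR (K \<times> C)"
  have "lex_nonneg (\<lambda>i. y $ i \<bullet> x)" if "x \<in> K" for x
    using *[unfolded FR_iff_lex_nonneg, rule_format, of "(x, 0)"] that assms by simp
  moreover have "lex_nonneg (\<lambda>i. z $ i \<bullet> w)" if "w \<in> C" for w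
    using *[unfolded FR_iff_lex_nonneg, rule_format, of "(0, w)"] that assms by simp
  ultimately show "y \<in> FR K \<and> z \<in> FR C"
    by (simp add: FR_iff_lex_nonneg)
qed (auto simp: FR_iff_lex_nonneg intro: lex_nonneg_add)

lemma closed_FR_subspace:
  assumes "subspace K"
  shows "closed (FR K :: ('a::real_inner ^ 'k::{finite,linorder}) set)"
proof -
  have "(FR K :: ('a, 'k) vec set) = (\<Inter>x\<in>K. \<Inter>i. {y. y $ i \<bullet> x = 0})"
  proof (intro equalityI subsetI)
    fix y :: "('a, 'k) vec"
    assume y: "y \<in> FR K"
    have "y $ i \<bullet> x = 0" if "x \<in> K" for i x
    proof (rule lex_nonneg_uminus_eq_0)
      show "lex_nonneg (\<lambda>i. y $ i \<bullet> x)"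
        using y that by (simp add: FR_iff_lex_nonneg)
      show "lex_nonneg (\<lambda>i. - (y $ i \<bullet> x))"
        using y subspace_neg[OF assms that] by (force simp: FR_iff_lex_nonneg)
    qed
    then show "y \<in> (\<Inter>x\<in>K. \<Inter>i. {y. y $ i \<bullet> x = 0})"
      by simp
  qed (simp add: FR_iff_lex_nonneg lex_nonneg_def)
  moreover have "closed {y :: ('a, 'k) vec. y $ i \<bullet> x = 0}" for i x
    by (intro closed_Collect_eq continuous_intros)
  ultimately show ?thesis
    by (simp add: closed_INT)
qed

lemma closed_FR_single:
  assumes "CARD('k::{finite,linorder}) = 1"
  shows "closed (FR K :: ('a::real_inner ^ 'k::{finite,linorder}) set)"
proof -
  obtain c where "(UNIV :: 'k set) = {c}"
    using assms by (rule card_1_singletonE)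
  then have "\<not> j < i" for i j :: 'k
    by (metis UNIV_I singletonD less_irrefl)
  then have "(FR K :: ('a, 'k) vec set) = (\<Inter>x\<in>K. \<Inter>i. {y. 0 \<le> y $ i \<bullet> x})"
    by (auto simp: FR_iff_lex_nonneg lex_nonneg_def)
  moreover have "closed {y :: ('a, 'k) vec. 0 \<le> y $ i \<bullet> x}" for i x
    by (intro closed_Collect_le continuous_intros)
  ultimately show ?thesis
    by (simp add: closed_INT)
qed

text \<open>A cone that is not a subspace contains some \<open>x\<close> but not \<open>-x\<close>. A hyperplane strictly
  separating \<open>-x\<close> from the cone can be moved to the origin, where its normal is the
  required functional.\<close>
lemma dual_cone_positive_if_not_subspace:
  fixes K :: "'a::euclidean_space set"
  assumes "closed K" "convex_cone K" "\<not> subspace K"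
  obtains a x where "a \<in> dual_cone K" "x \<in> K" "0 < a \<bullet> x"
proof -
  have K: "0 \<in> K" "\<And>x y. x \<in> K \<Longrightarrow> y \<in> K \<Longrightarrow> x + y \<in> K"
    "\<And>c x. 0 \<le> c \<Longrightarrow> x \<in> K \<Longrightarrow> c *\<^sub>R x \<in> K"
    using assms(2) by (auto simp: convex_cone_iff)
  obtain x where x: "x \<in> K" "- x \<notin> K"
  proof (rule ccontr)
    assume "\<not> thesis"
    then have neg: "- x \<in> K" if "x \<in> K" for x
      using that \<open>\<And>x. x \<in> K \<Longrightarrow> - x \<notin> K \<Longrightarrow> thesis\<close> by blast
    have "c *\<^sub>R x \<in> K" if "x \<in> K" for c x
      using K(3)[OF _ that, of c] K(3)[OF _ neg[OF that], of "- c"] by (cases "0 \<le> c") auto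
    then show False
      using K assms(3) by (auto simp: subspace_def)
  qed
  obtain a b where ab: "a \<bullet> (- x) < b" "\<And>w. w \<in> K \<Longrightarrow> b < a \<bullet> w"
    using separating_hyperplane_closed_point[of K "- x"] assms(1,2) x(2)
    by (auto simp: convex_cone_def)
  have "b < 0"
    using ab(2)[OF K(1)] by simp
  have "0 \<le> a \<bullet> w" if "w \<in> K" for w
  proof (rule ccontr)
    assume neg: "\<not> 0 \<le> a \<bullet> w"
    \<comment> \<open>the factor for which the multiple of \<open>w\<close> lies exactly on the separating hyperplane\<close>
    then have "(b / (a \<bullet> w)) *\<^sub>R w \<in> K"
      using K(3) that \<open>b < 0\<close> by (simp add: divide_nonpos_neg)
    from ab(2)[OF this] neg show False
      by simp
  qed
  then have "a \<in> dual_cone K"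
    by (simp add: dual_cone_def)
  moreover have "0 < a \<bullet> x"
    using ab(1) \<open>b < 0\<close> by simp
  ultimately show thesis
    using that x(1) by blast
qed

text \<open>However small, a positive entry in an earlier position outweighs the negative entry behind
  it, and it is lost in the limit.\<close>
lemma not_closed_FR:
  fixes K :: "'a::real_inner set" and p q :: "'k::{finite,linorder}"
  assumes a: "a \<in> dual_cone K" and x: "x \<in> K" "0 < a \<bullet> x" and "p < q"
  shows "\<not> closed (FR K :: ('a ^ 'k::{finite,linorder}) set)"
proof
  assume closed: "closed (FR K :: ('a, 'k) vec set)"
  define Y :: "real \<Rightarrow> ('a, 'k) vec"
    where "Y e = (\<chi> i. if i = p then e *\<^sub>R a else if i = q then - a else 0)" for e
  have inner_Y: "Y e $ i \<bullet> w = (if i = p then e * (a \<bullet> w) else if i = q then - (a \<bullet> w) else 0)"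
    for e i w
    by (simp add: Y_def)
  have "Y (1 / real (Suc n)) \<in> FR K" for n
    unfolding FR_iff_lex_nonneg
  proof
    fix w
    assume "w \<in> K"
    then have "0 \<le> a \<bullet> w"
      using a by (simp add: dual_cone_def)
    then show "lex_nonneg (\<lambda>i. Y (1 / real (Suc n)) $ i \<bullet> w)"
      using \<open>p < q\<close> by (auto simp: lex_nonneg_def inner_Y)
  qed
  moreover have "(\<lambda>n. Y (1 / real (Suc n))) \<longlonglongrightarrow> Y 0"
  proof (rule vec_tendstoI)
    fix i
    have "(\<lambda>n. (1 / real (Suc n)) *\<^sub>R a) \<longlonglongrightarrow> 0 *\<^sub>R a"
      by (intro tendsto_intros LIMSEQ_Suc lim_1_over_n)
    then show "(\<lambda>n. Y (1 / real (Suc n)) $ i) \<longlonglongrightarrow> Y 0 $ i"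
      by (simp add: Y_def)
  qed
  ultimately have "Y 0 \<in> FR K"
    by (rule closed_sequentially[OF closed])
  then have "lex_nonneg (\<lambda>i. Y 0 $ i \<bullet> x)"
    using x(1) by (simp add: FR_iff_lex_nonneg)
  then have "(\<forall>j<q. Y 0 $ j \<bullet> x = 0) \<longrightarrow> 0 \<le> Y 0 $ q \<bullet> x"
    unfolding lex_nonneg_def by (rule spec)
  then show False
    using x(2) \<open>p < q\<close> by (auto simp: inner_Y split: if_splits)
qed

lemma closed_FR_iff:
  fixes K :: "'a::euclidean_space set"
  assumes "closed K" "convex_cone K"
  shows "closed (FR K :: ('a ^ 'k::{finite,linorder}) set) \<longleftrightarrow> subspace K \<or> CARD('k) = 1"
proof
  assume closed: "closed (FR K :: ('a, 'k) vec set)"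
  show "subspace K \<or> CARD('k) = 1"
  proof (rule ccontr)
    assume "\<not> (subspace K \<or> CARD('k) = 1)"
    then have K: "\<not> subspace K" and k: "CARD('k) \<noteq> 1"
      by auto
    have "\<exists>p q :: 'k. p \<noteq> q"
      using k is_singletonI'[of "UNIV :: 'k set"] by (auto simp: is_singleton_altdef)
    then obtain p q :: 'k where "p < q"
      by (meson neqE)
    moreover obtain a x where "a \<in> dual_cone K" "x \<in> K" "0 < a \<bullet> x"
      using dual_cone_positive_if_not_subspace[OF assms K] .
    ultimately show False
      using not_closed_FR closed by blast
  qed
qed (auto intro: closed_FR_subspace closed_FR_single)

theorem lemma1:
  fixes K :: "'a::euclidean_space set"
  assumes "closed K" and "convex_cone K"
  shows "convex_cone (FR K :: ('a ^ 'k::{finite,linorder}) set) \<and>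
    (closed (FR K :: ('a ^ 'k::{finite,linorder}) set) \<longleftrightarrow> subspace K \<or> CARD('k) = 1) \<and>
    (\<forall>T\<in>Aut K. \<forall>y\<in>(FR K :: ('a ^ 'k::{finite,linorder}) set). (\<chi> i. adjoint T (y $ i)) \<in> (FR K :: ('a ^ 'k::{finite,linorder}) set)) \<and>
    (\<forall>C :: 'b::euclidean_space set. closed C \<and> convex_cone C \<longrightarrow>
      (\<forall>(y :: 'a ^ 'k::{finite,linorder}) (z :: 'b ^ 'k::{finite,linorder}).
        (\<chi> i. (y $ i, z $ i)) \<in> FR (K \<times> C) \<longleftrightarrow> y \<in> FR K \<and> z \<in> FR C))"
proof (intro conjI ballI allI impI)
  show "convex_cone (FR K :: ('a, 'k) vec set)"
    by (rule convex_cone_FR)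
  show "closed (FR K :: ('a, 'k) vec set) \<longleftrightarrow> subspace K \<or> CARD('k) = 1"
    by (rule closed_FR_iff[OF assms])
  show "(\<chi> i. adjoint T (y $ i)) \<in> FR K" if "T \<in> Aut K" "y \<in> FR K" for T and y :: "('a, 'k) vec"
    by (rule FR_adjoint[OF that])
  show "(\<chi> i. (y $ i, z $ i)) \<in> FR (K \<times> C) \<longleftrightarrow> y \<in> FR K \<and> z \<in> FR C"
    if "closed C \<and> convex_cone C" for C :: "'b set" and y :: "('a, 'k) vec" and z :: "('b, 'k) vec"
    using that assms(2) by (intro FR_Times_iff) (auto simp: convex_cone_contains_0)
qed

end
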